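(* Let $\Sigma=(X,\mathcal{U},\phi)$ be an ordered control system that is monotone with respect to inputs, with $\mathcal{U}(x)=\mathcal{U}$ for all $x\in X$. Let $\mathcal{U}_c$ be a subset of $\mathcal{U}$ and let the following two conditions hold: (i) There exists $\rho\in\mathcal{K}_\infty$ such that for any $x_-,x,x_+\in X$ satisfying $x_-\le x\le x_+$ it holds that $\|x\|_X\le\rho(\|x_-\|_X+\|x_+\|_X)$. (ii) There exists $\eta\in\mathcal{K}_\infty$ such that for any $u\in\mathcal{U}$ there are $u_-,u_+\in\mathcal{U}_c$ satisfying $u_-\le u\le u_+$, $\|u_-\|_{\mathcal{U}}\le\eta(\|u\|_{\mathcal{U}})$ and $\|u_+\|_{\mathcal{U}}\le\eta(\|u\|_{\mathcal{U}})$. Then $\Sigma$ is ISS if and only if $\Sigma$ is ISS with respect to inputs in $\mathcal{U}_c$. Moreover, if $\rho$ is linear, then $\Sigma$ is exp-ISS if and only if $\Sigma$ is exp-ISS with respect to inputs in $\mathcal{U}_c$. If additionally $\Sigma$ is exp-ISS with respect to inputs in $\mathcal{U}_c$ with a linear gain function and $\eta$ is linear, then $\Sigma$ is exp-ISS with a linear gain function.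
   Context: Comparison functions ($\mathbb{R}_+=[0,\infty)$): $\mathcal{K}$ is the set of continuous strictly increasing $\gamma:\mathbb{R}_+\to\mathbb{R}_+$ with $\gamma(0)=0$; $\mathcal{K}_\infty$ is the set of unbounded $\gamma\in\mathcal{K}$; $\mathcal{L}$ is the set of continuous strictly decreasing $\gamma:\mathbb{R}_+\to\mathbb{R}_+$ with $\lim_{t\to\infty}\gamma(t)=0$; $\mathcal{KL}$ is the set of continuous $\beta:\mathbb{R}_+\times\mathbb{R}_+\to\mathbb{R}_+$ with $\beta(\cdot,t)\in\mathcal{K}$ for all $t\ge0$ and $\beta(r,\cdot)\in\mathcal{L}$ for all $r>0$. Control system: a triple $\Sigma=(X,\mathcal{U},\phi)$ consisting of a normed linear space $(X,\|\cdot\|_X)$ (state space); a set $U$ of input values, which is a nonempty subset of a normed linear space; a normed linear space of inputs $\mathcal{U}\subset\{f:\mathbb{R}_+\to U\}$ with norm $\|\cdot\|_{\mathcal{U}}$, such that $u(\cdot+\tau)\in\mathcal{U}$ for all $u\in\mathcal{U}$, $\tau\ge0$; a family of nonempty sets $\mathcal{U}(x)\subset\mathcal{U}$, $x\in X$ (inputs admissible for the state $x$); and a transition map $\phi$, such that: ($\Sigma1$) $\phi(t,x,u)\in X$ is well defined for all $x\in X$, $u\in\mathcal{U}(x)$, $t\ge0$; ($\Sigma2$) $\phi(0,x,u)=x$ for all $x\in X$, $u\in\mathcal{U}(x)$; ($\Sigma3$) for all $t\ge 0$, $x\in X$, $u,\tilde u\in\mathcal{U}(x)$ with $u(s)=\tilde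 u(s)$ for $s\in[0,t]$ it holds that $\phi(t,x,u)=\phi(t,x,\tilde u)$; ($\Sigma4$) for all $t,h\ge0$, $x\in X$, $u\in\mathcal{U}(x)$ we have $u(t+\cdot)\in\mathcal{U}(\phi(t,x,u))$ and $\phi(h,\phi(t,x,u),u(t+\cdot))=\phi(t+h,x,u)$. Order: a positive cone in a normed linear space $X$ is a set $K\subset X$ with $K\cap(-K)=\{0\}$ that is closed under addition and under multiplication by scalars in $\mathbb{R}_+$; it induces the order $x\le y\Leftrightarrow y-x\in K$, and $X$ with such a cone is an ordered normed linear space. A control system is ordered if $X$ and $\mathcal{U}$ are ordered normed linear spaces. An ordered control system is monotone with respect to inputs if $\phi(t,x,u_1)\le\phi(t,x,u_2)$ for all $t\ge0$, $x\in X$ and $u_1,u_2\in\mathcal{U}(x)$ with $u_1\le u_2$. Stability: $\Sigma$ is ISS with respect to inputs in $\mathcal{U}_c\subset\mathcal{U}$ if there exist $\beta\in\mathcal{KL}$, $\gamma\in\mathcal{K}$ such that for every $x\in X$ with $\mathcal{U}(x)\cap\mathcal{U}_c\neq\emptyset$, all $u\in\mathcal{U}(x)\cap\mathcal{U}_c$ and all $t\ge0$: $\|\phi(t,x,u)\|_X\le\beta(\|x\|_X,t)+\gamma(\|u\|_{\mathcal{U}})$. $\Sigma$ is exp-ISS with respect to inputs in $\mathcal{U}_c$ if there exist constants $M,\lambda>0$ and $\gamma\in\mathcal{K}_\infty$ such that, for all the same $x,u,t$, $\|\phi(t,x,u)\|_X\le Me^{-\lambda t}\|x\|_X+\gamma(\|u\|_{\mathcal{U}})$;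 it is so with a linear gain function if moreover $\gamma$ can be chosen linear. $\Sigma$ is ISS (exp-ISS, exp-ISS with a linear gain function) if this holds with $\mathcal{U}_c=\mathcal{U}$. *)

theory Defs
  imports Complex_Main "HOL-Library.Function_Algebras"
begin

text \<open>Functions with values in a real vector space form a real vector space pointwise.\<close>

instantiation "fun" :: (type, real_vector) real_vector
begin

definition scaleR_fun :: "real \<Rightarrow> ('a \<Rightarrow> 'b) \<Rightarrow> 'a \<Rightarrow> 'b"
  where "scaleR_fun c f = (\<lambda>x. c *\<^sub>R f x)"

instance
  by standard (auto simp: scaleR_fun_def fun_eq_iff scaleR_add_right scaleR_add_left)

end


text \<open>Comparison functions. Functions on $[0,\infty)$ are represented by functions on all reals;
  only their values at nonnegative arguments are ever used.\<close>

definition class_K :: "(real \<Rightarrow> real) set" where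
  "class_K = {\<gamma>. \<gamma> ` {0..} \<subseteq> {0..} \<and> continuous_on {0..} \<gamma> \<and> strict_mono_on {0..} \<gamma> \<and> \<gamma> 0 = 0}"

definition class_K_inf :: "(real \<Rightarrow> real) set" where
  "class_K_inf = {\<gamma> \<in> class_K. \<not> bdd_above (\<gamma> ` {0..})}"

definition class_L :: "(real \<Rightarrow> real) set" where
  "class_L = {\<gamma>. \<gamma> ` {0..} \<subseteq> {0..} \<and> continuous_on {0..} \<gamma>
     \<and> (\<forall>s\<ge>0. \<forall>t>s. \<gamma> t < \<gamma> s) \<and> (\<gamma> \<longlongrightarrow> 0) at_top}"

definition class_KL :: "(real \<Rightarrow> real \<Rightarrow> real) set" where
  "class_KL = {\<beta>. continuous_on ({0..} \<times> {0..}) (\<lambda>(r, t). \<beta> r t)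
     \<and> (\<forall>t\<ge>0. (\<lambda>r. \<beta> r t) \<in> class_K) \<and> (\<forall>r>0. \<beta> r \<in> class_L)}"

definition linear_on_nonneg :: "(real \<Rightarrow> real) \<Rightarrow> bool" where
  "linear_on_nonneg \<gamma> \<longleftrightarrow> (\<exists>c. \<forall>r\<ge>0. \<gamma> r = c * r)"


definition positive_cone :: "'a::real_vector set \<Rightarrow> bool" where
  "positive_cone K \<longleftrightarrow> K \<inter> uminus ` K = {0}
     \<and> (\<forall>x\<in>K. \<forall>y\<in>K. x + y \<in> K) \<and> (\<forall>c\<ge>0. \<forall>x\<in>K. c *\<^sub>R x \<in> K)"

definition cone_le :: "'a::real_vector set \<Rightarrow> 'a \<Rightarrow> 'a \<Rightarrow> bool" where
  "cone_le K x y \<longleftrightarrow> y - x \<in> K"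

definition is_norm_on :: "'a::real_vector set \<Rightarrow> ('a \<Rightarrow> real) \<Rightarrow> bool" where
  "is_norm_on V N \<longleftrightarrow> (\<forall>x\<in>V. 0 \<le> N x) \<and> (\<forall>x\<in>V. N x = 0 \<longleftrightarrow> x = 0)
     \<and> (\<forall>c. \<forall>x\<in>V. N (c *\<^sub>R x) = \<bar>c\<bar> * N x) \<and> (\<forall>x\<in>V. \<forall>y\<in>V. N (x + y) \<le> N x + N y)"


text \<open>A map from $[0,\infty)$ to a vector space is represented by its extension by zero to the
  whole real line. This is compatible with the pointwise operations, and two such maps are equal
  iff they agree at all nonnegative times.\<close>

definition nonneg_time_maps :: "'v::real_vector set \<Rightarrow> (real \<Rightarrow> 'v) set" where
  "nonneg_time_maps W = {f. (\<forall>t\<ge>0. f t \<in> W) \<and> (\<forall>t<0. f t = 0)}"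

definition time_shift :: "real \<Rightarrow> (real \<Rightarrow> 'v::real_vector) \<Rightarrow> real \<Rightarrow> 'v" where
  "time_shift \<tau> u = (\<lambda>s. if s < 0 then 0 else u (s + \<tau>))"

text \<open>The state space is the whole type \<open>'x\<close> with its norm. The transition map is a total
  function, hence defined at all \<open>t \<ge> 0\<close> and all admissible inputs; its values at negative times and
  inadmissible inputs are unconstrained and irrelevant.\<close>

record ('x, 'v) control_system =
  input_values :: "'v set"
  inputs :: "(real \<Rightarrow> 'v) set"
  input_norm :: "(real \<Rightarrow> 'v) \<Rightarrow> real"
  admissible :: "'x \<Rightarrow> (real \<Rightarrow> 'v) set"
  trans_map :: "real \<Rightarrow> 'x \<Rightarrow> (real \<Rightarrow> 'v) \<Rightarrow> 'x"

locale control_system =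
  fixes \<Sigma> :: "('x::real_normed_vector, 'v::real_normed_vector, 'm) control_system_scheme"
  assumes input_values_nonempty: "input_values \<Sigma> \<noteq> {}"
    and inputs_subset: "inputs \<Sigma> \<subseteq> nonneg_time_maps (input_values \<Sigma>)"
    and inputs_subspace: "subspace (inputs \<Sigma>)"
    and inputs_norm: "is_norm_on (inputs \<Sigma>) (input_norm \<Sigma>)"
    and inputs_shift: "\<And>u \<tau>. u \<in> inputs \<Sigma> \<Longrightarrow> \<tau> \<ge> 0 \<Longrightarrow> time_shift \<tau> u \<in> inputs \<Sigma>"
    and admissible_nonempty: "\<And>x. admissible \<Sigma> x \<noteq> {}"
    and admissible_subset: "\<And>x. admissible \<Sigma> x \<subseteq> inputs \<Sigma>"
    and identity: "\<And>x u. u \<in> admissible \<Sigma> x \<Longrightarrow> trans_map \<Sigma> 0 x u = x"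
    and causality: "\<And>t x u u'. t \<ge> 0 \<Longrightarrow> u \<in> admissible \<Sigma> x \<Longrightarrow> u' \<in> admissible \<Sigma> x
        \<Longrightarrow> (\<And>s. s \<in> {0..t} \<Longrightarrow> u s = u' s) \<Longrightarrow> trans_map \<Sigma> t x u = trans_map \<Sigma> t x u'"
    and cocycle_admissible: "\<And>t x u. t \<ge> 0 \<Longrightarrow> u \<in> admissible \<Sigma> x
        \<Longrightarrow> time_shift t u \<in> admissible \<Sigma> (trans_map \<Sigma> t x u)"
    and cocycle: "\<And>t h x u. t \<ge> 0 \<Longrightarrow> h \<ge> 0 \<Longrightarrow> u \<in> admissible \<Sigma> x
        \<Longrightarrow> trans_map \<Sigma> h (trans_map \<Sigma> t x u) (time_shift t u) = trans_map \<Sigma> (t + h) x u"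

record ('x, 'v) ordered_control_system = "('x, 'v) control_system" +
  state_cone :: "'x set"
  input_cone :: "(real \<Rightarrow> 'v) set"

locale ordered_control_system = control_system \<Sigma>
  for \<Sigma> :: "('x::real_normed_vector, 'v::real_normed_vector, 'm) ordered_control_system_scheme" +
  assumes state_cone: "positive_cone (state_cone \<Sigma>)"
    and input_cone_subset: "input_cone \<Sigma> \<subseteq> inputs \<Sigma>"
    and input_cone: "positive_cone (input_cone \<Sigma>)"

definition monotone_wrt_inputs ::
  "('x::real_normed_vector, 'v::real_normed_vector, 'm) ordered_control_system_scheme \<Rightarrow> bool" where
  "monotone_wrt_inputs \<Sigma> \<longleftrightarrow>
     (\<forall>t\<ge>0. \<forall>x. \<forall>u1\<in>admissible \<Sigma> x. \<forall>u2\<in>admissible \<Sigma> x. cone_le (input_cone \<Sigma>) u1 u2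
        \<longrightarrow> cone_le (state_cone \<Sigma>) (trans_map \<Sigma> t x u1) (trans_map \<Sigma> t x u2))"


definition ISS_wrt ::
  "('x::real_normed_vector, 'v, 'm) control_system_scheme \<Rightarrow> (real \<Rightarrow> 'v) set \<Rightarrow> bool" where
  "ISS_wrt \<Sigma> Uc \<longleftrightarrow> (\<exists>\<beta>\<in>class_KL. \<exists>\<gamma>\<in>class_K.
     \<forall>x. \<forall>u\<in>admissible \<Sigma> x \<inter> Uc. \<forall>t\<ge>0.
       norm (trans_map \<Sigma> t x u) \<le> \<beta> (norm x) t + \<gamma> (input_norm \<Sigma> u))"

definition exp_ISS_estimate ::
  "('x::real_normed_vector, 'v, 'm) control_system_scheme \<Rightarrow> (real \<Rightarrow> 'v) set
     \<Rightarrow> real \<Rightarrow> real \<Rightarrow> (real \<Rightarrow> real) \<Rightarrow> bool" where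
  "exp_ISS_estimate \<Sigma> Uc M a \<gamma> \<longleftrightarrow> (\<forall>x. \<forall>u\<in>admissible \<Sigma> x \<inter> Uc. \<forall>t\<ge>0.
     norm (trans_map \<Sigma> t x u) \<le> M * exp (- a * t) * norm x + \<gamma> (input_norm \<Sigma> u))"

definition exp_ISS_wrt ::
  "('x::real_normed_vector, 'v, 'm) control_system_scheme \<Rightarrow> (real \<Rightarrow> 'v) set \<Rightarrow> bool" where
  "exp_ISS_wrt \<Sigma> Uc \<longleftrightarrow> (\<exists>M>0. \<exists>a>0. \<exists>\<gamma>\<in>class_K_inf. exp_ISS_estimate \<Sigma> Uc M a \<gamma>)"

definition exp_ISS_linear_gain_wrt ::
  "('x::real_normed_vector, 'v, 'm) control_system_scheme \<Rightarrow> (real \<Rightarrow> 'v) set \<Rightarrow> bool" where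
  "exp_ISS_linear_gain_wrt \<Sigma> Uc \<longleftrightarrow>
     (\<exists>M>0. \<exists>a>0. \<exists>\<gamma>\<in>class_K_inf. linear_on_nonneg \<gamma> \<and> exp_ISS_estimate \<Sigma> Uc M a \<gamma>)"

definition ISS :: "('x::real_normed_vector, 'v, 'm) control_system_scheme \<Rightarrow> bool" where
  "ISS \<Sigma> \<longleftrightarrow> ISS_wrt \<Sigma> (inputs \<Sigma>)"

definition exp_ISS :: "('x::real_normed_vector, 'v, 'm) control_system_scheme \<Rightarrow> bool" where
  "exp_ISS \<Sigma> \<longleftrightarrow> exp_ISS_wrt \<Sigma> (inputs \<Sigma>)"

definition exp_ISS_linear_gain ::
  "('x::real_normed_vector, 'v, 'm) control_system_scheme \<Rightarrow> bool" where
  "exp_ISS_linear_gain \<Sigma> \<longleftrightarrow> exp_ISS_linear_gain_wrt \<Sigma> (inputs \<Sigma>)"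

end

theory Submission
  imports Defs
begin

text \<open>Why the theorem holds. Restricting the class of inputs preserves every estimate, so only
  the passage from \<open>Uc\<close> to all inputs has content. An arbitrary input \<open>u\<close> lies between two inputs
  \<open>um\<close>, \<open>up\<close> of \<open>Uc\<close> whose norms are at most \<open>\<eta>\<close> of the norm of \<open>u\<close>. Monotonicity places the
  trajectory for \<open>u\<close> between the trajectories for \<open>um\<close> and \<open>up\<close>, which start at the same state and
  satisfy the assumed estimate; the order-to-norm bound \<open>\<rho>\<close> then gives, with \<open>b\<close> the transient
  term of that estimate and \<open>\<gamma>\<close> its gain,
  \<open>norm (\<phi> t x u) \<le> \<rho> (2 * (b + \<gamma> (\<eta> (norm of u))))\<close> (lemma \<open>trajectory_sandwich_bound\<close>).

  It remains to split the right-hand side into a transient term and a gain. For general \<open>\<rho>\<close> this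
  is the weak triangle inequality \<open>\<rho> (r + s) \<le> \<rho> (2 * r) + \<rho> (2 * s)\<close> (lemma \<open>class_K_weak_triangle\<close>);
  the factor four it produces, as well as \<open>\<rho>\<close> and \<open>\<eta>\<close>, are absorbed by the closure of the
  comparison classes under composition. A nonlinear \<open>\<rho>\<close> may destroy the form \<open>M * exp (- a * t) * norm x\<close> of
  the transient term, whereas a linear \<open>\<rho>\<close> keeps it and is simply distributed over the sum.\<close>

lemma class_K_mono: "\<gamma> \<in> class_K \<Longrightarrow> 0 \<le> r \<Longrightarrow> r \<le> s \<Longrightarrow> \<gamma> r \<le> \<gamma> s"
  unfolding class_K_def
  by (auto intro: strict_mono_on_leD[of "{0..}" \<gamma>])

lemma class_K_strict_mono: "\<gamma> \<in> class_K \<Longrightarrow> 0 \<le> r \<Longrightarrow> r < s \<Longrightarrow> \<gamma> r < \<gamma> s"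
  unfolding class_K_def
  by (auto intro: strict_mono_onD[of "{0..}" \<gamma>])

lemma class_K_nonneg: "\<gamma> \<in> class_K \<Longrightarrow> 0 \<le> r \<Longrightarrow> 0 \<le> \<gamma> r"
  unfolding class_K_def by auto

lemma class_K_continuous_comp:
  assumes "\<gamma> \<in> class_K" "continuous_on S f" "f ` S \<subseteq> {0..}"
  shows "continuous_on S (\<lambda>x. \<gamma> (f x))"
proof (rule continuous_on_compose2[OF _ assms(2,3)])
  show "continuous_on {0..} \<gamma>"
    using assms(1) unfolding class_K_def by simp
qed

lemma class_K_comp:
  assumes "\<gamma> \<in> class_K" "\<delta> \<in> class_K"
  shows "(\<lambda>r. \<gamma> (\<delta> r)) \<in> class_K"
proof -
  have "continuous_on {0..} (\<lambda>r. \<gamma> (\<delta> r))"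
    using assms(2) by (intro class_K_continuous_comp[OF assms(1)]) (simp_all add: class_K_def)
  moreover have "strict_mono_on {0..} (\<lambda>r. \<gamma> (\<delta> r))"
    by (rule strict_mono_onI)
      (auto intro!: class_K_strict_mono[OF assms(1)] class_K_strict_mono[OF assms(2)]
        class_K_nonneg[OF assms(2)])
  ultimately show ?thesis
    using assms unfolding class_K_def by auto
qed

lemma class_K_infD: "\<gamma> \<in> class_K_inf \<Longrightarrow> \<gamma> \<in> class_K"
  unfolding class_K_inf_def by simp

lemma class_K_inf_iff:
  "\<gamma> \<in> class_K_inf \<longleftrightarrow> \<gamma> \<in> class_K \<and> (\<forall>B. \<exists>r\<ge>0. B < \<gamma> r)"
  unfolding class_K_inf_def bdd_above_def by (auto simp: not_le)

lemma class_K_inf_comp: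
  assumes "\<gamma> \<in> class_K_inf" "\<delta> \<in> class_K_inf"
  shows "(\<lambda>r. \<gamma> (\<delta> r)) \<in> class_K_inf"
  unfolding class_K_inf_iff
proof (intro conjI allI)
  show "(\<lambda>r. \<gamma> (\<delta> r)) \<in> class_K"
    by (rule class_K_comp[OF class_K_infD[OF assms(1)] class_K_infD[OF assms(2)]])
  fix B
  obtain s where s: "s \<ge> 0" "B < \<gamma> s"
    using assms(1) unfolding class_K_inf_iff by blast
  obtain r where r: "r \<ge> 0" "s < \<delta> r"
    using assms(2) unfolding class_K_inf_iff by blast
  have "\<gamma> s < \<gamma> (\<delta> r)"
    by (rule class_K_strict_mono[OF class_K_infD[OF assms(1)] s(1) r(2)])
  with s r show "\<exists>r\<ge>0. B < \<gamma> (\<delta> r)" by (intro exI[of _ r]) auto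
qed

lemma scaling_class_K_inf:
  assumes "(c::real) > 0"
  shows "(\<lambda>r. c * r) \<in> class_K_inf"
proof -
  have "\<exists>r\<ge>0. B < c * r" for B
    using assms by (intro exI[of _ "(\<bar>B\<bar> + 1) / c"]) auto
  with assms show ?thesis
    unfolding class_K_inf_iff class_K_def
    by (auto intro!: continuous_intros strict_mono_onI)
qed

text \<open>The limit at infinity of the composition uses continuity of \<open>\<gamma>\<close> at 0 from the right only,
  which suffices because class L functions are nonnegative on nonnegative times.\<close>

lemma class_K_comp_class_L:
  assumes "\<gamma> \<in> class_K" "\<delta> \<in> class_L"
  shows "(\<lambda>t. \<gamma> (\<delta> t)) \<in> class_L"
proof -
  have pos: "\<delta> t \<ge> 0" if "t \<ge> 0" for t
    using assms(2) that unfolding class_L_def by auto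
  have "continuous_on {0..} (\<lambda>t. \<gamma> (\<delta> t))"
    using assms(2) by (intro class_K_continuous_comp[OF assms(1)]) (simp_all add: class_L_def)
  moreover have "((\<lambda>t. \<gamma> (\<delta> t)) \<longlongrightarrow> \<gamma> 0) at_top"
  proof (rule continuous_on_tendsto_compose[where f = \<gamma> and g = \<delta> and s = "{0..}"])
    show "\<forall>\<^sub>F t in at_top. \<delta> t \<in> {0..}"
      using eventually_ge_at_top[of 0] by eventually_elim (simp add: pos)
  qed (use assms in \<open>auto simp: class_K_def class_L_def\<close>)
  moreover have "\<gamma> (\<delta> t) < \<gamma> (\<delta> s)" if "s \<ge> 0" "t > s" for s t
    using assms(2) that by (intro class_K_strict_mono[OF assms(1)] pos) (auto simp: class_L_def)
  ultimately show ?thesis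
    using class_K_nonneg[OF assms(1) pos] assms(1) by (auto simp: class_L_def class_K_def)
qed

lemma class_K_comp_class_KL:
  assumes "\<gamma> \<in> class_K" "\<beta> \<in> class_KL"
  shows "(\<lambda>r t. \<gamma> (\<beta> r t)) \<in> class_KL"
proof -
  have K: "(\<lambda>r. \<beta> r t) \<in> class_K" if "t \<ge> 0" for t
    using assms(2) that unfolding class_KL_def by auto
  have "continuous_on ({0..} \<times> {0..}) (\<lambda>p. \<gamma> (case p of (r, t) \<Rightarrow> \<beta> r t))"
    using assms(2) class_K_nonneg[OF K]
    by (intro class_K_continuous_comp[OF assms(1)]) (auto simp: class_KL_def)
  then have "continuous_on ({0..} \<times> {0..}) (\<lambda>(r, t). \<gamma> (\<beta> r t))"
    by (simp add: case_prod_unfold)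
  with assms show ?thesis
    by (simp add: class_KL_def class_K_comp[OF assms(1)] class_K_comp_class_L)
qed

text \<open>The larger of the two summands dominates half of the sum.\<close>

lemma class_K_weak_triangle:
  assumes "\<rho> \<in> class_K" "r \<ge> 0" "s \<ge> 0"
  shows "\<rho> (r + s) \<le> \<rho> (2 * r) + \<rho> (2 * s)"
proof (cases "r \<le> s")
  case True
  have "\<rho> (r + s) \<le> \<rho> (2 * s)" "0 \<le> \<rho> (2 * r)"
    using assms True by (simp_all add: class_K_mono class_K_nonneg)
  then show ?thesis by linarith
next
  case False
  have "\<rho> (r + s) \<le> \<rho> (2 * r)" "0 \<le> \<rho> (2 * s)"
    using assms False by (simp_all add: class_K_mono class_K_nonneg)
  then show ?thesis by linarith
qed

lemma linear_class_K_coefficient: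
  assumes "\<rho> \<in> class_K" "linear_on_nonneg \<rho>"
  obtains c where "c > 0" "\<And>r. r \<ge> 0 \<Longrightarrow> \<rho> r = c * r"
proof -
  obtain c where c: "\<And>r. r \<ge> 0 \<Longrightarrow> \<rho> r = c * r"
    using assms(2) unfolding linear_on_nonneg_def by blast
  moreover have "c > 0"
    using class_K_strict_mono[OF assms(1), of 0 1] c[of 0] c[of 1] by simp
  ultimately show ?thesis using that by blast
qed

lemma linear_on_nonneg_comp:
  assumes "linear_on_nonneg \<gamma>" "linear_on_nonneg \<delta>" "\<delta> \<in> class_K"
  shows "linear_on_nonneg (\<lambda>r. \<gamma> (\<delta> r))"
proof -
  obtain a b where "\<And>r. r \<ge> 0 \<Longrightarrow> \<gamma> r = a * r" "\<And>r. r \<ge> 0 \<Longrightarrow> \<delta> r = b * r"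
    using assms(1,2) unfolding linear_on_nonneg_def by blast
  then have "\<forall>r\<ge>0. \<gamma> (\<delta> r) = (a * b) * r"
    using class_K_nonneg[OF assms(3)] by simp
  then show ?thesis unfolding linear_on_nonneg_def by blast
qed

lemma ISS_wrt_subset: "ISS_wrt \<Sigma> V \<Longrightarrow> Uc \<subseteq> V \<Longrightarrow> ISS_wrt \<Sigma> Uc"
  unfolding ISS_wrt_def by (elim bexE, intro bexI) auto

lemma exp_ISS_estimate_subset:
  "exp_ISS_estimate \<Sigma> V M a \<gamma> \<Longrightarrow> Uc \<subseteq> V \<Longrightarrow> exp_ISS_estimate \<Sigma> Uc M a \<gamma>"
  unfolding exp_ISS_estimate_def by auto

lemma exp_ISS_wrt_subset: "exp_ISS_wrt \<Sigma> V \<Longrightarrow> Uc \<subseteq> V \<Longrightarrow> exp_ISS_wrt \<Sigma> Uc"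
  unfolding exp_ISS_wrt_def by (blast intro: exp_ISS_estimate_subset)

text \<open>The time and the initial state are fixed here, so the transient term of the estimate enters
  only as a number \<open>b\<close>; this lets one bound serve both the asymptotic and the exponential
  variants of stability.\<close>

lemma trajectory_sandwich_bound:
  assumes "ordered_control_system \<Sigma>" and mono: "monotone_wrt_inputs \<Sigma>"
    and adm: "admissible \<Sigma> x = inputs \<Sigma>" and "Uc \<subseteq> inputs \<Sigma>"
    and "\<rho> \<in> class_K"
    and rho: "\<And>xm x xp. cone_le (state_cone \<Sigma>) xm x \<Longrightarrow> cone_le (state_cone \<Sigma>) x xp
           \<Longrightarrow> norm x \<le> \<rho> (norm xm + norm xp)"
    and eta: "\<exists>um\<in>Uc. \<exists>up\<in>Uc.
           cone_le (input_cone \<Sigma>) um u \<and> cone_le (input_cone \<Sigma>) u up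
           \<and> input_norm \<Sigma> um \<le> \<eta> (input_norm \<Sigma> u) \<and> input_norm \<Sigma> up \<le> \<eta> (input_norm \<Sigma> u)"
    and u: "u \<in> inputs \<Sigma>" and "\<gamma> \<in> class_K" and "t \<ge> 0"
    and est: "\<And>v. v \<in> Uc \<Longrightarrow> norm (trans_map \<Sigma> t x v) \<le> b + \<gamma> (input_norm \<Sigma> v)"
  shows "norm (trans_map \<Sigma> t x u) \<le> \<rho> (2 * (b + \<gamma> (\<eta> (input_norm \<Sigma> u))))"
proof -
  interpret ordered_control_system \<Sigma> by fact
  obtain um up where w: "um \<in> Uc" "up \<in> Uc"
      "cone_le (input_cone \<Sigma>) um u" "cone_le (input_cone \<Sigma>) u up"
      "input_norm \<Sigma> um \<le> \<eta> (input_norm \<Sigma> u)" "input_norm \<Sigma> up \<le> \<eta> (input_norm \<Sigma> u)"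
    using eta by blast
  have in_inputs: "um \<in> inputs \<Sigma>" "up \<in> inputs \<Sigma>"
    using w \<open>Uc \<subseteq> inputs \<Sigma>\<close> by auto
  have bound: "norm (trans_map \<Sigma> t x v) \<le> b + \<gamma> (\<eta> (input_norm \<Sigma> u))"
    if "v \<in> Uc" "v \<in> inputs \<Sigma>" "input_norm \<Sigma> v \<le> \<eta> (input_norm \<Sigma> u)" for v
  proof -
    have "0 \<le> input_norm \<Sigma> v"
      using inputs_norm that(2) unfolding is_norm_on_def by blast
    then have "\<gamma> (input_norm \<Sigma> v) \<le> \<gamma> (\<eta> (input_norm \<Sigma> u))"
      using class_K_mono[OF \<open>\<gamma> \<in> class_K\<close>] that(3) by blast
    with est[OF that(1)] show ?thesis by linarith
  qed
  have "cone_le (state_cone \<Sigma>) (trans_map \<Sigma> t x um) (trans_map \<Sigma> t x u)"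
    "cone_le (state_cone \<Sigma>) (trans_map \<Sigma> t x u) (trans_map \<Sigma> t x up)"
    using mono adm u in_inputs w \<open>t \<ge> 0\<close> unfolding monotone_wrt_inputs_def by blast+
  then have "norm (trans_map \<Sigma> t x u)
      \<le> \<rho> (norm (trans_map \<Sigma> t x um) + norm (trans_map \<Sigma> t x up))"
    by (rule rho)
  also have "\<dots> \<le> \<rho> (2 * (b + \<gamma> (\<eta> (input_norm \<Sigma> u))))"
    using bound[of um] bound[of up] w in_inputs
    by (intro class_K_mono[OF \<open>\<rho> \<in> class_K\<close>]) auto
  finally show ?thesis .
qed

theorem mainTheorem1:
  fixes \<Sigma> :: "('x::real_normed_vector, 'v::real_normed_vector) ordered_control_system"
    and Uc :: "(real \<Rightarrow> 'v) set"
    and \<rho> \<eta> :: "real \<Rightarrow> real"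
  assumes "ordered_control_system \<Sigma>"
    and "monotone_wrt_inputs \<Sigma>"
    and "\<forall>x. admissible \<Sigma> x = inputs \<Sigma>"
    and "Uc \<subseteq> inputs \<Sigma>"
    and "\<rho> \<in> class_K_inf"
    and "\<forall>xm x xp. cone_le (state_cone \<Sigma>) xm x \<and> cone_le (state_cone \<Sigma>) x xp
           \<longrightarrow> norm x \<le> \<rho> (norm xm + norm xp)"
    and "\<eta> \<in> class_K_inf"
    and "\<forall>u\<in>inputs \<Sigma>. \<exists>um\<in>Uc. \<exists>up\<in>Uc.
           cone_le (input_cone \<Sigma>) um u \<and> cone_le (input_cone \<Sigma>) u up
           \<and> input_norm \<Sigma> um \<le> \<eta> (input_norm \<Sigma> u) \<and> input_norm \<Sigma> up \<le> \<eta> (input_norm \<Sigma> u)"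
  shows "(ISS \<Sigma> \<longleftrightarrow> ISS_wrt \<Sigma> Uc)
    \<and> (linear_on_nonneg \<rho> \<longrightarrow> (exp_ISS \<Sigma> \<longleftrightarrow> exp_ISS_wrt \<Sigma> Uc))
    \<and> (linear_on_nonneg \<rho> \<longrightarrow> exp_ISS_linear_gain_wrt \<Sigma> Uc \<and> linear_on_nonneg \<eta>
         \<longrightarrow> exp_ISS_linear_gain \<Sigma>)"
proof -
  interpret ordered_control_system \<Sigma> by fact
  have rho: "\<rho> \<in> class_K" and eta: "\<eta> \<in> class_K"
    using assms by (auto intro: class_K_infD)
  have norm_nonneg: "0 \<le> input_norm \<Sigma> u" if "u \<in> inputs \<Sigma>" for u
    using inputs_norm that unfolding is_norm_on_def by blast
  have sandwich: "norm (trans_map \<Sigma> t x u) \<le> \<rho> (2 * (b + \<gamma> (\<eta> (input_norm \<Sigma> u))))"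
    if "u \<in> inputs \<Sigma>" "\<gamma> \<in> class_K" "t \<ge> 0"
      "\<And>v. v \<in> Uc \<Longrightarrow> norm (trans_map \<Sigma> t x v) \<le> b + \<gamma> (input_norm \<Sigma> v)"
    for t x u b \<gamma>
    by (rule trajectory_sandwich_bound[OF assms(1,2) _ assms(4) rho])
      (use assms(3,6,8) that in simp_all)
  have Uc_admissible: "v \<in> admissible \<Sigma> x \<inter> Uc" if "v \<in> Uc" for v x
    using assms(3,4) that by auto

  have iss_back: "ISS \<Sigma>" if iss: "ISS_wrt \<Sigma> Uc"
  proof -
    obtain \<beta> \<gamma> where \<beta>: "\<beta> \<in> class_KL" and \<gamma>: "\<gamma> \<in> class_K"
      and est: "\<forall>x. \<forall>u\<in>admissible \<Sigma> x \<inter> Uc. \<forall>t\<ge>0.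
        norm (trans_map \<Sigma> t x u) \<le> \<beta> (norm x) t + \<gamma> (input_norm \<Sigma> u)"
      using iss unfolding ISS_wrt_def by blast
    have \<rho>4: "(\<lambda>r. \<rho> (4 * r)) \<in> class_K"
      by (rule class_K_comp[OF rho class_K_infD[OF scaling_class_K_inf]]) simp
    have "norm (trans_map \<Sigma> t x u)
        \<le> \<rho> (4 * \<beta> (norm x) t) + \<rho> (4 * \<gamma> (\<eta> (input_norm \<Sigma> u)))"
      if u: "u \<in> inputs \<Sigma>" and t: "t \<ge> 0" for x u t
    proof -
      let ?b = "\<beta> (norm x) t" and ?g = "\<gamma> (\<eta> (input_norm \<Sigma> u))"
      have nonneg: "0 \<le> ?b" "0 \<le> ?g"
        using \<beta> t class_K_nonneg[of "\<lambda>r. \<beta> r t" "norm x"]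
          class_K_nonneg[OF \<gamma> class_K_nonneg[OF eta norm_nonneg[OF u]]]
        unfolding class_KL_def by auto
      have "norm (trans_map \<Sigma> t x u) \<le> \<rho> (2 * (?b + ?g))"
        using est Uc_admissible t by (intro sandwich[OF u \<gamma> t]) blast
      also have "\<dots> = \<rho> (2 * ?b + 2 * ?g)"
        by (simp add: distrib_left)
      also have "\<dots> \<le> \<rho> (4 * ?b) + \<rho> (4 * ?g)"
        using class_K_weak_triangle[OF rho, of "2 * ?b" "2 * ?g"] nonneg by simp
      finally show ?thesis .
    qed
    moreover have "(\<lambda>r t. \<rho> (4 * \<beta> r t)) \<in> class_KL"
      by (rule class_K_comp_class_KL[OF \<rho>4 \<beta>])
    moreover have "(\<lambda>r. \<rho> (4 * \<gamma> (\<eta> r))) \<in> class_K"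
      by (rule class_K_comp[OF \<rho>4 class_K_comp[OF \<gamma> eta]])
    ultimately show ?thesis
      unfolding ISS_def ISS_wrt_def
      by (intro bexI[of _ "\<lambda>r t. \<rho> (4 * \<beta> r t)"] bexI[of _ "\<lambda>r. \<rho> (4 * \<gamma> (\<eta> r))"]) auto
  qed
  have iss_forth: "ISS \<Sigma> \<Longrightarrow> ISS_wrt \<Sigma> Uc"
    unfolding ISS_def by (rule ISS_wrt_subset[OF _ assms(4)])

  \<comment> \<open>Stated for a fixed estimate, so that linearity of the new gain can be read off.\<close>
  have exp_step: "\<exists>c>0. exp_ISS_estimate \<Sigma> (inputs \<Sigma>) (c * M) a (\<lambda>r. c * \<gamma> (\<eta> r))"
    if lin: "linear_on_nonneg \<rho>" and M: "M > 0" and \<gamma>: "\<gamma> \<in> class_K"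
      and est: "exp_ISS_estimate \<Sigma> Uc M a \<gamma>" for M a \<gamma>
  proof -
    obtain c where c: "c > 0" "\<And>r. r \<ge> 0 \<Longrightarrow> \<rho> r = c * r"
      using linear_class_K_coefficient[OF rho lin] by blast
    have "norm (trans_map \<Sigma> t x u)
        \<le> 2 * c * M * exp (- a * t) * norm x + 2 * c * \<gamma> (\<eta> (input_norm \<Sigma> u))"
      if u: "u \<in> inputs \<Sigma>" and t: "t \<ge> 0" for x u t
    proof -
      let ?b = "M * exp (- a * t) * norm x" and ?g = "\<gamma> (\<eta> (input_norm \<Sigma> u))"
      have nonneg: "0 \<le> ?b" "0 \<le> ?g"
        using M class_K_nonneg[OF \<gamma> class_K_nonneg[OF eta norm_nonneg[OF u]]] by auto
      have "norm (trans_map \<Sigma> t x u) \<le> \<rho> (2 * (?b + ?g))"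
        using est Uc_admissible t unfolding exp_ISS_estimate_def
        by (intro sandwich[OF u \<gamma> t]) blast
      also have "\<dots> = c * (2 * (?b + ?g))"
        using nonneg by (intro c(2)) auto
      finally show ?thesis by (simp add: algebra_simps)
    qed
    then show ?thesis
      using c(1) unfolding exp_ISS_estimate_def by (intro exI[of _ "2 * c"]) auto
  qed
  have gain: "(\<lambda>r. c * \<gamma> (\<eta> r)) \<in> class_K_inf" if "c > 0" "\<gamma> \<in> class_K_inf" for c \<gamma>
    by (rule class_K_inf_comp[OF scaling_class_K_inf class_K_inf_comp]) (use that assms(7) in auto)
  have exp_back: "exp_ISS \<Sigma>" if lin: "linear_on_nonneg \<rho>" and iss: "exp_ISS_wrt \<Sigma> Uc"
  proof -
    obtain M a \<gamma> where *: "M > 0" "a > 0" "\<gamma> \<in> class_K_inf" "exp_ISS_estimate \<Sigma> Uc M a \<gamma>"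
      using iss unfolding exp_ISS_wrt_def by blast
    obtain c where c: "c > 0" "exp_ISS_estimate \<Sigma> (inputs \<Sigma>) (c * M) a (\<lambda>r. c * \<gamma> (\<eta> r))"
      using exp_step[OF lin *(1) class_K_infD[OF *(3)] *(4)] by blast
    have "c * M > 0" using c(1) *(1) by simp
    then show ?thesis
      unfolding exp_ISS_def exp_ISS_wrt_def using c(2) *(2) gain[OF c(1) *(3)] by blast
  qed
  have exp_forth: "exp_ISS \<Sigma> \<Longrightarrow> exp_ISS_wrt \<Sigma> Uc"
    unfolding exp_ISS_def by (rule exp_ISS_wrt_subset[OF _ assms(4)])
  have lin_back: "exp_ISS_linear_gain \<Sigma>"
    if lin: "linear_on_nonneg \<rho>" and iss: "exp_ISS_linear_gain_wrt \<Sigma> Uc"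
      and eta_lin: "linear_on_nonneg \<eta>"
  proof -
    obtain M a \<gamma> where *: "M > 0" "a > 0" "\<gamma> \<in> class_K_inf" "exp_ISS_estimate \<Sigma> Uc M a \<gamma>"
      and \<gamma>_lin: "linear_on_nonneg \<gamma>"
      using iss unfolding exp_ISS_linear_gain_wrt_def by blast
    obtain c where c: "c > 0" "exp_ISS_estimate \<Sigma> (inputs \<Sigma>) (c * M) a (\<lambda>r. c * \<gamma> (\<eta> r))"
      using exp_step[OF lin *(1) class_K_infD[OF *(3)] *(4)] by blast
    have "linear_on_nonneg (\<lambda>r. c * r)"
      unfolding linear_on_nonneg_def by blast
    then have "linear_on_nonneg (\<lambda>r. c * \<gamma> (\<eta> r))"
      by (rule linear_on_nonneg_comp[OF _ linear_on_nonneg_comp[OF \<gamma>_lin eta_lin eta]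
            class_K_comp[OF class_K_infD[OF *(3)] eta]])
    moreover have "c * M > 0" using c(1) *(1) by simp
    ultimately show ?thesis
      unfolding exp_ISS_linear_gain_def exp_ISS_linear_gain_wrt_def
      using c(2) *(2) gain[OF c(1) *(3)] by blast
  qed
  show ?thesis
    using iss_back iss_forth exp_back exp_forth lin_back by blast
qed

end
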